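(* Let $s\ge1$ be an integer and $0=c_0<c_1<\cdots<c_s=1$. Let $a_{ij},\widehat a_{ij}$ ($1\le i\le s$, $0\le j\le s$) be the unique real coefficients satisfying, for $i=1,\ldots,s$, the polynomial identity $$\frac{\Pi_i(z)-Q_s(z)}{z}=\sum_{j=0}^s a_{ij}\Pi_j(z)+z\sum_{j=0}^s\widehat a_{ij}\Pi_j(z),$$ and put $A=(a_{ij})_{i,j=1}^s$, $\widehat A=(\widehat a_{ij})_{i,j=1}^s$. Then $$\det\left(I-zA-z^2\widehat A\right)=Q_s(z).$$
   Context: $P_s$ and $Q_s$ are the numerator and denominator, normalized by $Q_s(0)=1$, of the Padé approximant $[s-1/s+1]_{e^z}=P_s/Q_s$ of the exponential (i.e. $\deg P_s\le s-1$, $\deg Q_s\le s+1$, $Q_s(z)e^z-P_s(z)=\mathcal O(z^{2s+1})$ as $z\to0$); explicitly $$P_s(z)=\sum_{k=0}^{s-1}\frac{(2s-k)!\,(s-1)!}{(2s)!\,k!\,(s-1-k)!}z^k,\qquad Q_s(z)=\sum_{k=0}^{s+1}\frac{(2s-k)!\,(s+1)!}{(2s)!\,k!\,(s+1-k)!}(-z)^k.$$ For $j=0,\ldots,s$, $\Pi_j(z)$ is the Taylor truncation at degree $2s$ (terms of degree $\le2s$ retained) of $Q_s(z)e^{c_jz}$; in particular $\Pi_0=Q_s$ and $\Pi_s=P_s$. The polynomials $\Pi_0,\ldots,\Pi_s,z\Pi_0,\ldots,z\Pi_s$ form a basis of the space of real polynomials of degree at most $2s+1$, and $(\Pi_i-Q_s)/z$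 is a polynomial of degree at most $2s-1$, so the coefficients $a_{ij},\widehat a_{ij}$ exist and are unique. $I$ is the $s\times s$ identity matrix. Note that the columns $j=0$ of the coefficients are not part of $A$, $\widehat A$. *)

theory Defs
  imports
    "HOL-Computational_Algebra.Polynomial_FPS"
    "Jordan_Normal_Form.Determinant"
begin

(* Numerator and denominator of the Pade approximant [s-1/s+1] of exp, for s \<ge> 1;
   the defining conditions are proved in pade_conditions below. *)

definition pade_num :: "nat \<Rightarrow> real poly" where
  "pade_num s = (\<Sum>k\<le>s - 1.
     monom (fact (2*s - k) * fact (s - 1) / (fact (2*s) * fact k * fact (s - 1 - k))) k)"

definition pade_den :: "nat \<Rightarrow> real poly" where
  "pade_den s = (\<Sum>k\<le>s + 1.
     monom ((-1) ^ k * (fact (2*s - k) * fact (s + 1) / (fact (2*s) * fact k * fact (s + 1 - k)))) k)"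

(* The Taylor polynomial of degree 2s of Q\<^sub>s(z) exp (x z); \<Pi>\<^sub>j is trunc_poly s (c j). *)

definition trunc_poly :: "nat \<Rightarrow> real \<Rightarrow> real poly" where
  "trunc_poly s x = (\<Sum>n\<le>2*s. monom (fps_nth (fps_of_poly (pade_den s) * fps_exp x) n) n)"

(* JNF matrices are indexed from 0: entry (i,j) is the coefficient with indices i+1, j+1,
   so column 0 of the coefficients is dropped. *)

definition coeff_mat :: "nat \<Rightarrow> (nat \<Rightarrow> nat \<Rightarrow> real) \<Rightarrow> real mat" where
  "coeff_mat s a = mat s s (\<lambda>(i, j). a (i + 1) (j + 1))"

lemma coeff_pade_den:
  "coeff (pade_den s) k = (if k \<le> s + 1 then
     (-1) ^ k * (fact (2*s - k) * fact (s + 1) / (fact (2*s) * fact k * fact (s + 1 - k))) else 0)"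
  by (auto simp: pade_den_def coeff_sum sum.delta' simp del: fact_Suc)

lemma coeff_pade_num:
  "coeff (pade_num s) k = (if k \<le> s - 1 then
     fact (2*s - k) * fact (s - 1) / (fact (2*s) * fact k * fact (s - 1 - k)) else 0)"
  by (simp add: pade_num_def coeff_sum sum.delta' del: fact_Suc)

lemma coeff_trunc_poly:
  "coeff (trunc_poly s x) n =
     (if n \<le> 2*s then fps_nth (fps_of_poly (pade_den s) * fps_exp x) n else 0)"
  by (simp add: trunc_poly_def coeff_sum sum.delta')

lemma alternating_choose_sum:
  fixes m N n :: nat
  assumes "m \<le> N"
  shows "(\<Sum>k\<le>m. (-1) ^ k * real (m choose k) * (if k \<le> n then real ((N - k) choose (n - k)) else 0))
         = real ((N - m) choose n)"
  using assms
proof (induction m arbitrary: N n)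
  case 0
  then show ?case by simp
next
  case (Suc m)
  let ?f = "\<lambda>N n k. (if k \<le> n then real ((N - k) choose (n - k)) else 0)"
  have "(\<Sum>k\<le>Suc m. (-1) ^ k * real (Suc m choose k) * ?f N n k)
      = ?f N n 0 + (\<Sum>k\<le>m. (-1) ^ Suc k * real (Suc m choose Suc k) * ?f N n (Suc k))"
    by (subst sum.atMost_Suc_shift) simp
  also have "(\<Sum>k\<le>m. (-1) ^ Suc k * real (Suc m choose Suc k) * ?f N n (Suc k))
      = (\<Sum>k\<le>m. (-1) ^ Suc k * real (m choose Suc k) * ?f N n (Suc k))
        - (\<Sum>k\<le>m. (-1) ^ k * real (m choose k) * ?f N n (Suc k))"
    by (subst sum_subtractf [symmetric], rule sum.cong) (simp_all add: algebra_simps)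
  also have "?f N n 0 + ((\<Sum>k\<le>m. (-1) ^ Suc k * real (m choose Suc k) * ?f N n (Suc k))
        - (\<Sum>k\<le>m. (-1) ^ k * real (m choose k) * ?f N n (Suc k)))
      = (\<Sum>k\<le>Suc m. (-1) ^ k * real (m choose k) * ?f N n k)
        - (\<Sum>k\<le>m. (-1) ^ k * real (m choose k) * ?f N n (Suc k))"
    by (subst sum.atMost_Suc_shift [of _ m]) simp
  also have "(\<Sum>k\<le>Suc m. (-1) ^ k * real (m choose k) * ?f N n k)
      = (\<Sum>k\<le>m. (-1) ^ k * real (m choose k) * ?f N n k)"
    by simp
  also have "\<dots> = real ((N - m) choose n)"
    using Suc.prems by (intro Suc.IH) simp
  also have "(\<Sum>k\<le>m. (-1) ^ k * real (m choose k) * ?f N n (Suc k))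
      = (if n = 0 then 0 else real ((N - Suc m) choose (n - 1)))"
  proof (cases n)
    case n: (Suc n')
    have "(\<Sum>k\<le>m. (-1) ^ k * real (m choose k) * ?f N n (Suc k))
        = (\<Sum>k\<le>m. (-1) ^ k * real (m choose k) * ?f (N - 1) n' k)"
      by (rule sum.cong) (auto simp: n)
    also have "\<dots> = real ((N - 1 - m) choose n')"
      using Suc.prems by (intro Suc.IH) simp
    finally show ?thesis by (simp add: n)
  qed simp
  finally have eq: "(\<Sum>k\<le>Suc m. (-1) ^ k * real (Suc m choose k) * ?f N n k)
      = real ((N - m) choose n) - (if n = 0 then 0 else real ((N - Suc m) choose (n - 1)))" .
  show ?case
  proof (cases n)
    case 0
    then show ?thesis using eq by (simp del: sum.atMost_Suc)
  next
    case n: (Suc n')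
    have "N - m = Suc (N - Suc m)" using Suc.prems by simp
    then have "real ((N - m) choose n) = real ((N - Suc m) choose n') + real ((N - Suc m) choose n)"
      by (simp add: n)
    with eq show ?thesis by (simp add: n del: sum.atMost_Suc)
  qed
qed

lemma coeff_pade_den_times_exp:
  assumes "s \<ge> 1" "n \<le> 2*s"
  shows "fps_nth (fps_of_poly (pade_den s) * fps_exp 1) n = coeff (pade_num s) n"
proof -
  define C where "C = (fact (2*s - n) / fact (2*s) :: real)"
  let ?g = "\<lambda>k. (-1) ^ k * real ((s + 1) choose k) *
                (if k \<le> n then real ((2*s - k) choose (n - k)) else 0)"
  have term_eq: "coeff (pade_den s) k / fact (n - k) = C * ?g k" if "k \<le> n" for k
  proof (cases "k \<le> s + 1")
    case True
    have b1: "real ((s + 1) choose k) = fact (s + 1) / (fact k * fact (s + 1 - k))"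
      by (rule binomial_fact) (use True in simp)
    have b2: "real ((2*s - k) choose (n - k)) =
        fact (2*s - k) / (fact (n - k) * fact (2*s - k - (n - k)))"
      by (rule binomial_fact) (use assms that in simp)
    have "2*s - k - (n - k) = 2*s - n" using assms that by simp
    then have "?g k = (-1) ^ k * (fact (s + 1) / (fact k * fact (s + 1 - k))) *
        (fact (2*s - k) / (fact (n - k) * fact (2*s - n)))"
      by (simp only: b1 b2 that if_True)
    then show ?thesis
      using True by (simp add: coeff_pade_den C_def mult_ac del: fact_Suc)
  qed (simp add: coeff_pade_den binomial_eq_0)
  have "fps_nth (fps_of_poly (pade_den s) * fps_exp 1) n
      = (\<Sum>k=0..n. coeff (pade_den s) k / fact (n - k))"
    by (simp add: fps_mult_nth)
  also have "\<dots> = (\<Sum>k=0..n. C * ?g k)"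
    by (rule sum.cong) (use term_eq in auto)
  also have "\<dots> = (\<Sum>k\<le>n + (s + 1). C * ?g k)"
    by (rule sum.mono_neutral_left) auto
  also have "\<dots> = (\<Sum>k\<le>s + 1. C * ?g k)"
    by (rule sum.mono_neutral_right) (auto simp: binomial_eq_0)
  also have "\<dots> = C * real ((2*s - (s + 1)) choose n)"
    unfolding sum_distrib_left [symmetric]
    by (subst alternating_choose_sum) (use assms in auto)
  also have "2*s - (s + 1) = s - 1" by simp
  also have "C * real ((s - 1) choose n) = coeff (pade_num s) n"
  proof (cases "n \<le> s - 1")
    case True
    then show ?thesis
      by (simp add: C_def coeff_pade_num binomial_fact field_simps del: fact_Suc)
  qed (simp add: coeff_pade_num binomial_eq_0)
  finally show ?thesis .
qed

lemma pade_conditions: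
  assumes "s \<ge> 1"
  shows "degree (pade_num s) \<le> s - 1"
    and "degree (pade_den s) \<le> s + 1"
    and "poly (pade_den s) 0 = 1"
    and "fps_X ^ (2*s + 1) dvd (fps_of_poly (pade_den s) * fps_exp 1 - fps_of_poly (pade_num s))"
proof -
  show "degree (pade_num s) \<le> s - 1"
    by (rule degree_le) (simp add: coeff_pade_num)
  show "degree (pade_den s) \<le> s + 1"
    by (rule degree_le) (simp add: coeff_pade_den)
  show "poly (pade_den s) 0 = 1"
    by (simp add: poly_0_coeff_0 coeff_pade_den del: fact_Suc)
  let ?F = "fps_of_poly (pade_den s) * fps_exp 1 - fps_of_poly (pade_num s)"
  have "fps_cutoff (2*s + 1) ?F = 0"
    using assms by (simp add: fps_eq_iff coeff_pade_den_times_exp)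
  then have "?F = fps_X ^ (2*s + 1) * fps_shift (2*s + 1) ?F"
    using fps_shift_cutoff'[of "2*s + 1" ?F] by simp
  then show "fps_X ^ (2*s + 1) dvd ?F" by (rule dvdI)
qed

lemma trunc_poly_0: "s \<ge> 1 \<Longrightarrow> trunc_poly s 0 = pade_den s"
  by (auto simp: poly_eq_iff coeff_trunc_poly coeff_pade_den)

lemma trunc_poly_1: "s \<ge> 1 \<Longrightarrow> trunc_poly s 1 = pade_num s"
  by (auto simp: poly_eq_iff coeff_trunc_poly coeff_pade_den_times_exp coeff_pade_num)

lemma X_dvd_trunc_poly_diff: "[:0, 1:] dvd trunc_poly s x - pade_den s"
  by (simp add: dvd_iff_poly_eq_0 poly_0_coeff_0 coeff_trunc_poly coeff_pade_den
        del: fact_Suc)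

end

theory Submission
  imports Defs
begin

text \<open>On the polynomials of degree at most \<open>2 s + 1\<close> consider the map
  \<open>T p = (p - p(0) Q\<^sub>s) / z\<close>. In the basis of monomials its matrix is a companion matrix \<open>C\<close> with
  \<open>det (I - z C) = Q\<^sub>s\<close>. In the basis \<open>\<Pi>\<^sub>j, z \<Pi>\<^sub>j\<close> the defining identities say that \<open>T\<close> has the block
  matrix with rows \<open>(A', H')\<close> and \<open>(I, 0)\<close>, where \<open>A'\<close> and \<open>H'\<close> are the full coefficient
  matrices, including column 0, with a zero row 0 (as \<open>T Q\<^sub>s = 0\<close>). Eliminating the second block turns
  \<open>det (I - z T)\<close> into \<open>det (I - z A' - z\<^sup>2 H')\<close>, and expanding along row 0 leaves the determinant in
  question.\<close>

section \<open>Companion matrices and linear pencils\<close>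

text \<open>Rows are images of monomials under the division map: for \<open>q\<close> with constant
  term 1 and degree at most \<open>n\<close>, row 0 holds the coefficients of
  \<open>(1 - q) / x\<close>, and row \<open>i > 0\<close> those of
  \<open>x^(i - 1)\<close>.\<close>

definition companion :: "nat \<Rightarrow> 'a::comm_ring_1 poly \<Rightarrow> 'a mat" where
  "companion n q = mat n n (\<lambda>(i, j). if i = 0 then - coeff q (Suc j) else if i = Suc j then 1 else 0)"

lemma companion_dim [simp]:
  "companion n q \<in> carrier_mat n n" "dim_row (companion n q) = n" "dim_col (companion n q) = n"
  by (simp_all add: companion_def)

lemma index_companion:
  "i < n \<Longrightarrow> j < n \<Longrightarrow>
     companion n q $$ (i, j) = (if i = 0 then - coeff q (Suc j) else if i = Suc j then 1 else 0)"
  by (simp add: companion_def)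

text \<open>For square \<open>K\<close> the determinant of the pencil is the reversed characteristic
  polynomial of \<open>K\<close>.\<close>

definition pencil :: "'a::comm_ring_1 mat \<Rightarrow> 'a poly mat" where
  "pencil K = 1\<^sub>m (dim_row K) - [:0, 1:] \<cdot>\<^sub>m map_mat (\<lambda>x. [:x:]) K"

lemma pencil_dim [simp]: "dim_row (pencil K) = dim_row K" "dim_col (pencil K) = dim_col K"
  by (simp_all add: pencil_def)

lemma pencil_carrier [simp]: "K \<in> carrier_mat n n \<Longrightarrow> pencil K \<in> carrier_mat n n"
  unfolding pencil_def by auto

lemma index_pencil:
  "K \<in> carrier_mat n n \<Longrightarrow> i < n \<Longrightarrow> j < n \<Longrightarrow>
     pencil K $$ (i, j) = (if i = j then 1 else 0) - [:0, 1:] * [:K $$ (i, j):]"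
  unfolding pencil_def by auto

text \<open>The relation lifts to \<open>pencil K * B = B * pencil C\<close> over the polynomial
  ring; in a domain the nonzero \<open>det B\<close> cancels, without inverting
  \<open>B\<close>.\<close>

lemma det_pencil_similar:
  fixes K B C :: "'a::idom mat"
  assumes K: "K \<in> carrier_mat n n" and B: "B \<in> carrier_mat n n" and C: "C \<in> carrier_mat n n"
    and KB: "K * B = B * C" and det: "det B \<noteq> 0"
  shows "det (pencil K) = det (pencil C)"
proof -
  interpret lift: comm_ring_hom "\<lambda>x::'a. [:x:]" by unfold_locales auto
  let ?h = "map_mat (\<lambda>x::'a. [:x:])"
  have car: "?h K \<in> carrier_mat n n" "?h B \<in> carrier_mat n n" "?h C \<in> carrier_mat n n"
    using K B C by auto
  have "pencil K * ?h B = ?h B - [:0, 1:] \<cdot>\<^sub>m (?h K * ?h B)"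
    using K car unfolding pencil_def
    by (subst minus_mult_distrib_mat[of _ n n _ _ n]) auto
  also have "?h K * ?h B = ?h B * ?h C"
    using lift.mat_hom_mult[OF K B] lift.mat_hom_mult[OF B C] KB by simp
  also have "?h B - [:0, 1:] \<cdot>\<^sub>m (?h B * ?h C) = ?h B * pencil C"
    using C car unfolding pencil_def
    by (subst mult_minus_distrib_mat[of _ n n _ n])
       (auto simp: mult_smult_distrib[of _ n n _ n])
  finally have "det (pencil K) * det (?h B) = det (?h B) * det (pencil C)"
    using K C car by (metis det_mult pencil_carrier)
  moreover have "det (?h B) \<noteq> 0" using det by simp
  ultimately show ?thesis by (metis mult.commute mult_right_cancel)
qed

lemma sum_coeff_Suc_monom:
  assumes "degree q \<le> n"
  shows "q = [:coeff q 0:] + (\<Sum>k<n. monom (coeff q (Suc k)) (Suc k))"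
proof -
  have "q = (\<Sum>k\<le>n. monom (coeff q k) k)"
    using assms by (simp add: poly_as_sum_of_monoms')
  also have "\<dots> = [:coeff q 0:] + (\<Sum>k<n. monom (coeff q (Suc k)) (Suc k))"
    by (simp add: lessThan_Suc_atMost[symmetric] sum.lessThan_Suc_shift monom_0 del: sum.lessThan_Suc)
  finally show ?thesis .
qed

text \<open>The lower unitriangular matrix of the powers \<open>x^(i - j)\<close> makes the pencil upper triangular.\<close>

lemma det_pencil_companion:
  fixes q :: "'a::idom poly"
  assumes deg: "degree q \<le> n" and q0: "coeff q 0 = 1"
  shows "det (pencil (companion n q)) = q"
proof (cases "n = 0")
  case True
  then have "q = [:coeff q 0:]" using deg by (metis degree_0_id le_zero_eq)
  then have "q = 1" using q0 by (simp add: one_pCons)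
  moreover have "pencil (companion n q) \<in> carrier_mat 0 0"
    using True by (intro pencil_carrier) (simp add: companion_def)
  ultimately show ?thesis by simp
next
  case False
  define U :: "'a poly mat" where "U = mat n n (\<lambda>(i, j). if j \<le> i then monom 1 (i - j) else 0)"
  let ?P = "pencil (companion n q)"
  have C: "companion n q \<in> carrier_mat n n" by simp
  have U: "U \<in> carrier_mat n n" by (simp add: U_def)
  have "diag_mat U = replicate n 1"
    unfolding diag_mat_def using U by (auto simp: U_def intro!: nth_equalityI)
  then have detU: "det U = 1"
    using det_lower_triangular[OF _ U] by (simp add: U_def)
  have PU: "(?P * U) $$ (i, j) = (\<Sum>k<n. ?P $$ (i, k) * U $$ (k, j))" if "i < n" "j < n" for i j
    using that U pencil_carrier[OF C]
    by (auto simp: scalar_prod_def lessThan_atLeast0 intro!: sum.cong)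
  \<comment> \<open>A row \<open>i > 0\<close> of the pencil has only 1 on the diagonal and
    \<open>-x\<close> just left of it, so neighbouring powers in \<open>U\<close> cancel.\<close>
  have rest: "(?P * U) $$ (i, j) = (if i = j then 1 else 0)" if "0 < i" "i < n" "j < n" for i j
  proof -
    obtain i' where i: "i = Suc i'" using \<open>0 < i\<close> not0_implies_Suc by blast
    have "(\<Sum>k<n. ?P $$ (i, k) * U $$ (k, j))
        = (\<Sum>k<n. (if i = k then U $$ (k, j) else 0) - (if k = i' then [:0, 1:] * U $$ (k, j) else 0))"
      using that C i
      by (intro sum.cong) (auto simp: index_pencil[OF C] index_companion one_pCons[symmetric] left_diff_distrib)
    also have "\<dots> = U $$ (i, j) - [:0, 1:] * U $$ (i', j)"
      using that i by (simp add: sum_subtractf)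
    also have "\<dots> = (if i = j then 1 else 0)"
      using that i by (auto simp: U_def monom_0 monom_Suc Suc_diff_le le_Suc_eq)
    finally show ?thesis using PU that by simp
  qed
  \<comment> \<open>Row 0 of the pencil is the unit row plus \<open>x\<close> times the coefficients
    of \<open>q\<close> from index 1 on; against the powers \<open>x^k\<close> it reassembles
    \<open>q\<close>.\<close>
  have corner: "(?P * U) $$ (0, 0) = q"
  proof -
    have "(\<Sum>k<n. ?P $$ (0, k) * U $$ (k, 0))
        = (\<Sum>k<n. (if 0 = k then U $$ (k, 0) else 0) + monom (coeff q (Suc k)) (Suc k))"
      using False C
      by (intro sum.cong)
         (auto simp: index_pencil[OF C] index_companion U_def monom_Suc monom_0 one_pCons smult_monom distrib_right)
    also have "\<dots> = U $$ (0, 0) + (\<Sum>k<n. monom (coeff q (Suc k)) (Suc k))"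
      using False by (simp add: sum.distrib)
    also have "\<dots> = q"
      using sum_coeff_Suc_monom[OF deg] False q0 by (simp add: U_def one_pCons)
    finally show ?thesis using PU False by simp
  qed
  have car: "?P * U \<in> carrier_mat n n" by (rule mult_carrier_mat[OF pencil_carrier[OF C] U])
  have "upper_triangular (?P * U)"
    using car rest by (auto simp: upper_triangular_def)
  then have "det (?P * U) = prod_list (diag_mat (?P * U))"
    using det_upper_triangular car by blast
  also have "diag_mat (?P * U) = q # replicate (n - 1) 1"
    unfolding diag_mat_def using False car corner rest
    by (intro nth_equalityI) (auto simp: nth_Cons')
  also have "prod_list \<dots> = q"
    by simp
  finally show ?thesis
    using det_mult[OF pencil_carrier[OF C] U] detU by simp
qed

text \<open>The rows of \<open>K\<close> express \<open>p \<mapsto> (p - p(0) q) / x\<close> in the basis \<open>b\<close>; in the monomial basis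
  the same map is the companion matrix of \<open>q\<close>.\<close>

lemma det_pencil_division_by_X:
  fixes q :: "'a::idom poly" and b :: "nat \<Rightarrow> 'a poly"
  assumes q: "degree q \<le> n" "coeff q 0 = 1"
    and K: "K \<in> carrier_mat n n"
    and deg: "\<And>i. i < n \<Longrightarrow> degree (b i) < n"
    and step: "\<And>i. i < n \<Longrightarrow>
          b i - Polynomial.smult (coeff (b i) 0) q = [:0, 1:] * (\<Sum>l<n. Polynomial.smult (K $$ (i, l)) (b l))"
    and det: "det (mat n n (\<lambda>(i, j). coeff (b i) j)) \<noteq> 0"
  shows "det (pencil K) = q"
proof -
  let ?B = "mat n n (\<lambda>(i, j). coeff (b i) j)"
  have C: "companion n q \<in> carrier_mat n n" by simp
  have "K * ?B = ?B * companion n q"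
  proof (rule eq_matI)
    fix i j assume "i < dim_row (?B * companion n q)" "j < dim_col (?B * companion n q)"
    then have ij: "i < n" "j < n" by (auto simp: companion_def)
    have "(K * ?B) $$ (i, j) = (\<Sum>l<n. K $$ (i, l) * coeff (b l) j)"
      using ij K by (auto simp: scalar_prod_def lessThan_atLeast0 intro!: sum.cong)
    also have "\<dots> = coeff ([:0, 1:] * (\<Sum>l<n. Polynomial.smult (K $$ (i, l)) (b l))) (Suc j)"
      by (simp add: coeff_sum)
    also have "\<dots> = coeff (b i) (Suc j) - coeff (b i) 0 * coeff q (Suc j)"
      using step[OF ij(1)] by (metis coeff_diff coeff_smult)
    \<comment> \<open>Column \<open>j\<close> of the companion matrix is supported on rows
      \<open>Suc j\<close> and 0. If \<open>Suc j = n\<close>, the first term is absent and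
      \<open>degree (b i) < n\<close> makes the coefficient vanish.\<close>
    also have "\<dots> = (\<Sum>l<n. (if l = Suc j then coeff (b i) l else 0)
                       - (if l = 0 then coeff (b i) 0 * coeff q (Suc j) else 0))"
      using ij deg[OF ij(1)] by (auto simp: sum_subtractf coeff_eq_0)
    also have "\<dots> = (\<Sum>l<n. coeff (b i) l * companion n q $$ (l, j))"
      using ij by (intro sum.cong) (auto simp: index_companion)
    also have "\<dots> = (?B * companion n q) $$ (i, j)"
      using ij C by (auto simp: scalar_prod_def lessThan_atLeast0 intro!: sum.cong)
    finally show "(K * ?B) $$ (i, j) = (?B * companion n q) $$ (i, j)" .
  qed (use K in \<open>auto simp: companion_def\<close>)
  then have "det (pencil K) = det (pencil (companion n q))"
    using det_pencil_similar[OF K _ C _ det] by simp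
  with q show ?thesis by (simp add: det_pencil_companion)
qed

text \<open>Linearization of a quadratic pencil: the lower blocks \<open>-x I\<close> and
  \<open>I\<close> commute, so the block determinant is that of the product of the diagonal blocks
  minus the product of the off-diagonal ones.\<close>

lemma det_pencil_second_order:
  fixes A H :: "'a::idom mat"
  assumes A: "A \<in> carrier_mat n n" and H: "H \<in> carrier_mat n n"
  shows "det (pencil (four_block_mat A H (1\<^sub>m n) (0\<^sub>m n n))) =
    det (1\<^sub>m n - [:0, 1:] \<cdot>\<^sub>m map_mat (\<lambda>x. [:x:]) A - [:0, 1:]^2 \<cdot>\<^sub>m map_mat (\<lambda>x. [:x:]) H)"
proof -
  let ?h = "map_mat (\<lambda>x::'a. [:x:])"
  let ?K = "four_block_mat A H (1\<^sub>m n) (0\<^sub>m n n)"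
  let ?X = "[:0, 1:] :: 'a poly"
  have K: "?K \<in> carrier_mat (n + n) (n + n)" using A H by simp
  have "pencil ?K = four_block_mat (1\<^sub>m n - ?X \<cdot>\<^sub>m ?h A) (- (?X \<cdot>\<^sub>m ?h H)) (- (?X \<cdot>\<^sub>m 1\<^sub>m n)) (1\<^sub>m n)"
    (is "_ = ?F")
  proof (rule eq_matI)
    fix i j assume "i < dim_row ?F" "j < dim_col ?F"
    then have ij: "i < n + n" "j < n + n" using A by auto
    show "pencil ?K $$ (i, j) = ?F $$ (i, j)"
      unfolding index_pencil[OF K ij] using A H ij
      by (auto simp: one_pCons)
  qed (use A H in \<open>auto simp: pencil_def\<close>)
  also have "det ?F = det ((1\<^sub>m n - ?X \<cdot>\<^sub>m ?h A) * 1\<^sub>m n - (- (?X \<cdot>\<^sub>m ?h H)) * (- (?X \<cdot>\<^sub>m 1\<^sub>m n)))"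
    using A H by (intro det_four_block_mat) auto
  also have "(- (?X \<cdot>\<^sub>m ?h H)) * (- (?X \<cdot>\<^sub>m 1\<^sub>m n)) = ?X^2 \<cdot>\<^sub>m ?h H"
    using H by (intro eq_matI) (auto simp: scalar_prod_def if_distrib sum.delta power2_eq_square cong: if_cong)
  finally show ?thesis using A H by (simp add: right_mult_one_mat[of _ n n])
qed

section \<open>Linear independence of the \<open>\<Pi>\<^sub>j\<close> and
  \<open>z \<Pi>\<^sub>j\<close>\<close>

text \<open>A zero determinant would give a kernel vector of the transpose, that is, a relation
  between the rows; by the degree bound it is a relation between the polynomials.\<close>

lemma det_coeff_mat_nonzero:
  fixes b :: "nat \<Rightarrow> 'a::idom poly"
  assumes deg: "\<And>i. i < n \<Longrightarrow> degree (b i) < n"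
    and indep: "\<And>v i. (\<Sum>l<n. Polynomial.smult (v l) (b l)) = 0 \<Longrightarrow> i < n \<Longrightarrow> v i = 0"
  shows "det (mat n n (\<lambda>(i, j). coeff (b i) j)) \<noteq> 0"
proof
  let ?B = "mat n n (\<lambda>(i, j). coeff (b i) j)"
  assume "det ?B = 0"
  then have "det (transpose_mat ?B) = 0" by (subst det_transpose[of _ n]) auto
  then obtain v where v: "v \<in> carrier_vec n" "v \<noteq> 0\<^sub>v n" "transpose_mat ?B *\<^sub>v v = 0\<^sub>v n"
    using det_0_iff_vec_prod_zero[of "transpose_mat ?B" n] by auto
  have "coeff (\<Sum>l<n. Polynomial.smult (v $ l) (b l)) k = 0" for k
  proof (cases "k < n")
    case True
    have "coeff (\<Sum>l<n. Polynomial.smult (v $ l) (b l)) k = (transpose_mat ?B *\<^sub>v v) $ k"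
      using True v(1) by (auto simp: coeff_sum scalar_prod_def lessThan_atLeast0 mult.commute intro!: sum.cong)
    then show ?thesis using v(3) True by simp
  next
    case False
    have "coeff (b l) k = 0" if "l < n" for l
      using False deg[OF that] by (intro coeff_eq_0) simp
    then show ?thesis by (simp add: coeff_sum)
  qed
  then have "(\<Sum>l<n. Polynomial.smult (v $ l) (b l)) = 0" by (simp add: poly_eq_iff)
  then have "v = 0\<^sub>v n" using indep[of "\<lambda>l. v $ l"] v(1) by auto
  with v(2) show False by simp
qed

text \<open>The factorials \<open>(2 s - k)!\<close> cancel and leave the binomial expansion of
  \<open>(x - 1)^(s + 1)\<close>. This is the coefficient of \<open>z^(2 s)\<close> in
  \<open>trunc_poly s x\<close>.\<close>

lemma coeff_pade_den_times_exp_top: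
  assumes "s \<ge> 1"
  shows "fps_nth (fps_of_poly (pade_den s) * fps_exp x) (2*s) = x^(s - 1) * (x - 1)^(s + 1) / fact (2*s)"
proof -
  have "fps_nth (fps_of_poly (pade_den s) * fps_exp x) (2*s)
      = (\<Sum>k=0..2*s. coeff (pade_den s) k * (x^(2*s - k) / fact (2*s - k)))"
    by (simp add: fps_mult_nth)
  also have "\<dots> = (\<Sum>k\<le>s + 1. coeff (pade_den s) k * (x^(2*s - k) / fact (2*s - k)))"
    using assms by (intro sum.mono_neutral_right) (auto simp: coeff_pade_den)
  also have "\<dots> = (\<Sum>k\<le>s + 1. x^(s - 1) / fact (2*s) *
                      (real ((s + 1) choose k) * (-1)^k * x^(s + 1 - k)))"
  proof (rule sum.cong)
    fix k assume "k \<in> {..s + 1}"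
    then have k: "k \<le> s + 1" by simp
    have pow: "x^(2*s - k) = x^(s - 1) * x^(s + 1 - k)"
      using k assms by (simp flip: power_add mult_2)
    have ch: "real ((s + 1) choose k) = fact (s + 1) / (fact k * fact (s + 1 - k))"
      using k by (rule binomial_fact)
    show "coeff (pade_den s) k * (x^(2*s - k) / fact (2*s - k)) = x^(s - 1) / fact (2*s) *
            (real ((s + 1) choose k) * (-1)^k * x^(s + 1 - k))"
      unfolding pow ch using k by (simp add: coeff_pade_den del: fact_Suc)
  qed simp
  also have "\<dots> = x^(s - 1) / fact (2*s) * (-1 + x)^(s + 1)"
    unfolding binomial_ring sum_distrib_left by simp
  finally show ?thesis by simp
qed

text \<open>Test with \<open>(x - c j) (x - c k) E\<^sup>2\<close>, where \<open>E\<close> vanishes at the other nodes: this gives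
  \<open>\<beta> j E(c j)\<^sup>2 = \<beta> k E(c k)\<^sup>2\<close>.\<close>

lemma hermite_functional_sgn_eq:
  fixes c \<alpha> \<beta> :: "'i \<Rightarrow> real"
  assumes J: "finite J" and inj: "inj_on c J"
    and F: "\<And>p. degree p + 2 \<le> 2 * card J \<Longrightarrow>
              (\<Sum>j\<in>J. \<alpha> j * poly p (c j) + \<beta> j * poly (pderiv p) (c j)) = 0"
    and j: "j \<in> J" and k: "k \<in> J"
  shows "sgn (\<beta> j) = sgn (\<beta> k)"
proof (cases "j = k")
  case False
  define E where "E = (\<Prod>i\<in>J - {j, k}. [:- c i, 1:])"
  define L where "L = [:- c j, 1:] * [:- c k, 1:]"
  have E0: "poly E (c i) = 0" if "i \<in> J" "i \<noteq> j" "i \<noteq> k" for i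
    using that J by (auto simp: E_def poly_prod)
  have E1: "poly E (c i) \<noteq> 0" if "i = j \<or> i = k" for i
    using that inj j k J by (auto simp: E_def poly_prod dest: inj_onD)
  have L: "poly L (c j) = 0" "poly L (c k) = 0" by (simp_all add: L_def)
  have card: "card (J - {j, k}) + 2 = card J"
    using j k J False card_mono[of J "{j, k}"] by (simp add: card_Diff_subset)
  have "degree E = card (J - {j, k})"
    unfolding E_def by (subst degree_prod_eq_sum_degree) auto
  moreover have "degree L = 2" by (simp add: L_def)
  moreover have "degree (L * E^2) \<le> degree L + 2 * degree E"
    by (metis degree_mult_le degree_power_le add_left_mono le_trans mult.commute)
  \<comment> \<open>The degree bound is \<open>2 + 2 (card J - 2)\<close>, exactly what
    \<open>F\<close> admits.\<close>
  ultimately have "degree (L * E^2) + 2 \<le> 2 * card J" using card by simp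
  from F[OF this]
  have "0 = (\<Sum>i\<in>J. \<alpha> i * poly (L * E^2) (c i) + \<beta> i * poly (pderiv (L * E^2)) (c i))" ..
  also have "\<dots> = (\<Sum>i\<in>J. \<beta> i * (poly (pderiv L) (c i) * poly E (c i)^2))"
  proof (rule sum.cong)
    fix i assume "i \<in> J"
    \<comment> \<open>\<open>L E\<close> vanishes at every node, so of value and derivative only the
      term \<open>L' E^2\<close> survives.\<close>
    then have "poly L (c i) = 0 \<or> poly E (c i) = 0" using L E0 by metis
    then show "\<alpha> i * poly (L * E^2) (c i) + \<beta> i * poly (pderiv (L * E^2)) (c i)
        = \<beta> i * (poly (pderiv L) (c i) * poly E (c i)^2)"
      by (auto simp: pderiv_mult power2_eq_square)
  qed simp
  also have "\<dots> = (\<Sum>i\<in>{j, k}. \<beta> i * (poly (pderiv L) (c i) * poly E (c i)^2))"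
    using J j k E0 by (intro sum.mono_neutral_right) auto
  also have "\<dots> = (c j - c k) * (\<beta> j * poly E (c j)^2 - \<beta> k * poly E (c k)^2)"
    using False by (simp add: L_def pderiv_mult pderiv_pCons algebra_simps)
  finally have "\<beta> j * poly E (c j)^2 = \<beta> k * poly E (c k)^2"
    using False inj j k by (auto dest: inj_onD)
  then have "sgn (\<beta> j) * sgn (poly E (c j)^2) = sgn (\<beta> k) * sgn (poly E (c k)^2)"
    by (metis sgn_mult)
  moreover have "sgn (poly E (c i)^2) = 1" if "i = j \<or> i = k" for i
    using E1[OF that] by (intro sgn_pos) simp
  ultimately show ?thesis by simp
qed simp

text \<open>Testing with the product of the \<open>x - c i\<close> over the other nodes isolates
  \<open>\<alpha> j\<close>.\<close>

lemma lagrange_functional_zero: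
  fixes c \<alpha> :: "'i \<Rightarrow> real"
  assumes J: "finite J" and inj: "inj_on c J"
    and F: "\<And>p. degree p < card J \<Longrightarrow> (\<Sum>j\<in>J. \<alpha> j * poly p (c j)) = 0"
    and j: "j \<in> J"
  shows "\<alpha> j = 0"
proof -
  define E where "E = (\<Prod>i\<in>J - {j}. [:- c i, 1:])"
  have "degree E = card (J - {j})"
    unfolding E_def by (subst degree_prod_eq_sum_degree) auto
  then have "degree E < card J" using J j by (metis card_Diff1_less)
  from F[OF this] have "0 = (\<Sum>i\<in>J. \<alpha> i * poly E (c i))" ..
  also have "\<dots> = (\<Sum>i\<in>{j}. \<alpha> i * poly E (c i))"
    using J j by (intro sum.mono_neutral_right) (auto simp: E_def poly_prod)
  finally have "\<alpha> j * poly E (c j) = 0" by simp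
  moreover have "poly E (c j) \<noteq> 0"
    using inj j J by (auto simp: E_def poly_prod dest: inj_onD)
  ultimately show ?thesis by simp
qed

text \<open>By the relation, \<open>Q\<^sub>s(z)\<close> times the sum of the
  \<open>(\<alpha> j + \<beta> j z) exp (c j z)\<close> has no terms up to \<open>z^(2 s)\<close>.
  As \<open>Q\<^sub>s(0) = 1\<close>, neither has the sum itself; \<open>n!\<close> times its
  coefficient is the functional with weights \<open>\<alpha> j\<close> on \<open>p(c j)\<close> and
  \<open>\<beta> j\<close> on \<open>p'(c j)\<close>, taken at \<open>p = x^n\<close>.\<close>

lemma trunc_polys_moments:
  fixes \<alpha> \<beta> c :: "nat \<Rightarrow> real"
  assumes zero: "(\<Sum>j\<in>J. Polynomial.smult (\<alpha> j) (trunc_poly s (c j))) +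
      [:0, 1:] * (\<Sum>j\<in>J. Polynomial.smult (\<beta> j) (trunc_poly s (c j))) = 0"
    and n: "n \<le> 2*s"
  shows "(\<Sum>j\<in>J. \<alpha> j * c j^n + \<beta> j * (of_nat n * c j^(n - 1))) = 0"
proof -
  define G where "G = (\<Sum>j\<in>J. (fps_const (\<alpha> j) + fps_const (\<beta> j) * fps_X) * fps_exp (c j))"
  let ?Q = "fps_of_poly (pade_den s)"
  have QG: "fps_nth (?Q * G) m = 0" if "m \<le> 2*s" for m
  proof -
    have "?Q * G = (\<Sum>j\<in>J. fps_const (\<alpha> j) * (?Q * fps_exp (c j)))
                     + fps_X * (\<Sum>j\<in>J. fps_const (\<beta> j) * (?Q * fps_exp (c j)))"
      by (simp add: G_def sum_distrib_left sum.distrib[symmetric] algebra_simps)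
    then have "fps_nth (?Q * G) m = coeff ((\<Sum>j\<in>J. Polynomial.smult (\<alpha> j) (trunc_poly s (c j))) +
      [:0, 1:] * (\<Sum>j\<in>J. Polynomial.smult (\<beta> j) (trunc_poly s (c j)))) m"
      using that by (cases m) (simp_all add: fps_sum_nth coeff_sum coeff_trunc_poly)
    then show ?thesis unfolding zero by simp
  qed
  have Q0: "fps_nth ?Q 0 = 1" by (simp add: coeff_pade_den del: fact_Suc)
  have "fps_nth G n = 0"
    using n
  proof (induction n rule: less_induct)
    case (less n)
    have "fps_nth (?Q * G) n = (\<Sum>i=0..n. fps_nth ?Q i * fps_nth G (n - i))"
      by (simp add: fps_mult_nth)
    also have "\<dots> = (\<Sum>i=0..n. if i = 0 then fps_nth G n else 0)"
      using less Q0 by (intro sum.cong) auto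
    finally show ?case using QG[OF less.prems] by simp
  qed
  then have "fact n * fps_nth G n = 0" by simp
  also have "fact n * fps_nth G n = (\<Sum>j\<in>J. \<alpha> j * c j^n + \<beta> j * (of_nat n * c j^(n - 1)))"
    unfolding G_def fps_sum_nth sum_distrib_left
  proof (rule sum.cong)
    fix j
    show "fact n * fps_nth ((fps_const (\<alpha> j) + fps_const (\<beta> j) * fps_X) * fps_exp (c j)) n
        = \<alpha> j * c j^n + \<beta> j * (of_nat n * c j^(n - 1))"
    proof (cases n)
      case (Suc m)
      have "fps_nth ((fps_const (\<alpha> j) + fps_const (\<beta> j) * fps_X) * fps_exp (c j)) n
          = \<alpha> j * (c j^n / fact n) + \<beta> j * (c j^m / fact m)"
        by (simp add: Suc distrib_right mult.assoc del: fact_Suc)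
      then have "fact n * fps_nth ((fps_const (\<alpha> j) + fps_const (\<beta> j) * fps_X) * fps_exp (c j)) n
          = \<alpha> j * c j^n + \<beta> j * (fact n / fact m * c j^m)"
        by (simp add: distrib_left)
      also have "fact n / fact m = (of_nat n :: real)" by (simp add: Suc)
      finally show ?thesis by (simp add: Suc)
    qed simp
  qed simp
  finally show ?thesis .
qed

text \<open>All \<open>\<beta> j\<close> have the same sign, and by the coefficient of \<open>z^(2 s + 1)\<close> the sum of the
  \<open>\<beta> j g(c j)\<close> is 0 for \<open>g(x) = x^(s - 1) (x - 1)^(s + 1)\<close>. As \<open>g\<close> has constant sign on \<open>[0, 1]\<close> and
  does not vanish at all \<open>c j\<close>, every \<open>\<beta> j\<close> is 0.\<close>

lemma trunc_polys_independent:
  fixes \<alpha> \<beta> c :: "nat \<Rightarrow> real"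
  assumes s: "s \<ge> 1" and c0: "c 0 = 0" and cs: "c s = 1" and mono: "strict_mono_on {0..s} c"
    and zero: "(\<Sum>j=0..s. Polynomial.smult (\<alpha> j) (trunc_poly s (c j))) +
      [:0, 1:] * (\<Sum>j=0..s. Polynomial.smult (\<beta> j) (trunc_poly s (c j))) = 0"
    and j: "j \<le> s"
  shows "\<alpha> j = 0 \<and> \<beta> j = 0"
proof -
  have inj: "inj_on c {0..s}" using mono strict_mono_on_imp_inj_on by blast
  have F: "(\<Sum>j=0..s. \<alpha> j * poly p (c j) + \<beta> j * poly (pderiv p) (c j)) = 0"
    if p: "degree p \<le> 2*s" for p
  proof -
    have "(\<Sum>j=0..s. \<alpha> j * poly p (c j) + \<beta> j * poly (pderiv p) (c j))
       = (\<Sum>j=0..s. \<Sum>n\<le>2*s. coeff p n * (\<alpha> j * c j^n + \<beta> j * (of_nat n * c j^(n - 1))))"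
    proof (rule sum.cong)
      fix j
      have P: "p = (\<Sum>n\<le>2*s. monom (coeff p n) n)"
        using p by (simp add: poly_as_sum_of_monoms')
      have "poly p (c j) = (\<Sum>n\<le>2*s. coeff p n * c j^n)"
        using arg_cong[OF P, of "\<lambda>p. poly p (c j)"] by (simp add: poly_sum poly_monom)
      moreover have "poly (pderiv p) (c j) = (\<Sum>n\<le>2*s. coeff p n * (of_nat n * c j^(n - 1)))"
        using arg_cong[OF P, of "\<lambda>p. poly (pderiv p) (c j)"]
        by (simp add: higher_pderiv_sum[of 1, simplified] poly_sum pderiv_monom poly_monom mult_ac)
      ultimately show "\<alpha> j * poly p (c j) + \<beta> j * poly (pderiv p) (c j)
          = (\<Sum>n\<le>2*s. coeff p n * (\<alpha> j * c j^n + \<beta> j * (of_nat n * c j^(n - 1))))"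
        by (simp add: sum_distrib_left sum.distrib[symmetric] algebra_simps)
    qed simp
    also have "\<dots> = (\<Sum>n\<le>2*s. coeff p n * (\<Sum>j=0..s. \<alpha> j * c j^n + \<beta> j * (of_nat n * c j^(n - 1))))"
      by (subst sum.swap) (simp only: sum_distrib_left)
    also have "\<dots> = 0"
      using trunc_polys_moments[OF zero] by simp
    finally show ?thesis .
  qed
  \<comment> \<open>There are \<open>s + 1\<close> nodes, so the test polynomials have degree at
    most \<open>2 (s + 1) - 2 = 2 s\<close>, as \<open>F\<close> requires.\<close>
  have sgn: "sgn (\<beta> i) = sgn (\<beta> 0)" if "i \<le> s" for i
    using hermite_functional_sgn_eq[of "{0..s}" c \<alpha> \<beta> i 0] inj F that by simp
  \<comment> \<open>This is \<open>x^(s - 1) (x - 1)^(s + 1)\<close> up to the sign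
    \<open>(-1)^(s + 1)\<close>, which makes it nonnegative on [0, 1].\<close>
  define w where "w x = x^(s - 1) * (1 - x)^(s + 1)" for x :: real
  have "coeff ((\<Sum>j=0..s. Polynomial.smult (\<alpha> j) (trunc_poly s (c j))) +
      [:0, 1:] * (\<Sum>j=0..s. Polynomial.smult (\<beta> j) (trunc_poly s (c j)))) (Suc (2*s))
    = (\<Sum>j=0..s. \<beta> j * (c j^(s - 1) * (c j - 1)^(s + 1) / fact (2*s)))"
    using coeff_pade_den_times_exp_top[OF s] by (simp add: coeff_sum coeff_trunc_poly)
  also have "\<dots> = (\<Sum>j=0..s. ((-1)^(s + 1) / fact (2*s)) * (\<beta> j * w (c j)))"
  proof (rule sum.cong)
    fix j
    have "(c j - 1)^(s + 1) = (-1)^(s + 1) * (1 - c j)^(s + 1)"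
      unfolding power_mult_distrib[symmetric] by simp
    then show "\<beta> j * (c j^(s - 1) * (c j - 1)^(s + 1) / fact (2*s))
        = ((-1)^(s + 1) / fact (2*s)) * (\<beta> j * w (c j))"
      by (simp only: w_def) simp
  qed simp
  finally have sum0: "(\<Sum>j=0..s. \<beta> j * w (c j)) = 0"
    unfolding zero sum_distrib_left[symmetric] by simp
  have c01: "0 \<le> c i \<and> c i \<le> 1" if "i \<le> s" for i
    using that c0 cs strict_mono_on_leD[OF mono, of 0 i] strict_mono_on_leD[OF mono, of i s] by auto
  have w: "w (c i) \<ge> 0" if "i \<le> s" for i
    using c01[OF that] by (simp add: w_def)
  \<comment> \<open>For \<open>s = 1\<close> the factor \<open>x^(s - 1)\<close> is 1 even at 0, so
    node 0 serves; for larger \<open>s\<close> both end nodes are zeros of \<open>w\<close> and the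
    interior node \<open>c 1\<close> serves.\<close>
  have "\<exists>m\<le>s. w (c m) > 0"
  proof (cases "s = 1")
    case True
    then show ?thesis by (intro exI[of _ 0]) (simp add: w_def c0)
  next
    case False
    then have "0 < c 1" "c 1 < 1"
      using s c0 cs strict_mono_onD[OF mono, of 0 1] strict_mono_onD[OF mono, of 1 s] by auto
    then show ?thesis using s by (intro exI[of _ 1]) (simp add: w_def)
  qed
  then obtain m where m: "m \<le> s" "w (c m) > 0" by blast
  \<comment> \<open>Multiplying by the common sign turns the vanishing sum into one of nonnegative
    terms.\<close>
  have "sgn (\<beta> 0) * (\<beta> i * w (c i)) = \<bar>\<beta> i\<bar> * w (c i)" if "i \<le> s" for i
    unfolding sgn[OF that, symmetric] abs_sgn by simp
  then have "(\<Sum>i=0..s. \<bar>\<beta> i\<bar> * w (c i)) = sgn (\<beta> 0) * (\<Sum>i=0..s. \<beta> i * w (c i))"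
    unfolding sum_distrib_left by (intro sum.cong refl) (metis atLeastAtMost_iff)
  then have "(\<Sum>i=0..s. \<bar>\<beta> i\<bar> * w (c i)) = 0" using sum0 by simp
  then have "\<bar>\<beta> m\<bar> * w (c m) = 0"
    using w m by (subst (asm) sum_nonneg_eq_0_iff) auto
  then have "\<beta> m = 0" using m by simp
  then have \<beta>: "\<beta> i = 0" if "i \<le> s" for i
    using sgn[OF that] sgn[OF m(1)] by (simp add: sgn_0_0)
  \<comment> \<open>With all \<open>\<beta> i\<close> zero only point values remain, and degrees
    below \<open>s + 1\<close> are within the range \<open>2 s\<close> of \<open>F\<close>.\<close>
  have "\<alpha> j = 0"
    using lagrange_functional_zero[of "{0..s}" c \<alpha> j] inj F \<beta> j by simp
  with \<beta> j show ?thesis by simp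
qed

section \<open>The division map in the basis of the \<open>\<Pi>\<^sub>j\<close> and
  \<open>z \<Pi>\<^sub>j\<close>\<close>

lemma sum_lessThan_add:
  fixes f :: "nat \<Rightarrow> 'a::comm_monoid_add"
  shows "(\<Sum>l<m + n. f l) = (\<Sum>l<m. f l) + (\<Sum>l<n. f (m + l))"
  by (induction n) (simp_all add: add.assoc)

theorem theorem5p4:
  fixes s :: nat and c :: "nat \<Rightarrow> real" and a a_hat :: "nat \<Rightarrow> nat \<Rightarrow> real"
  assumes "s \<ge> 1"
    and "c 0 = 0" and "c s = 1" and "strict_mono_on {0..s} c"
    and "\<And>i. i \<in> {1..s} \<Longrightarrow>
           (trunc_poly s (c i) - pade_den s) div [:0, 1:] =
             (\<Sum>j=0..s. Polynomial.smult (a i j) (trunc_poly s (c j))) +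
             [:0, 1:] * (\<Sum>j=0..s. Polynomial.smult (a_hat i j) (trunc_poly s (c j)))"
  shows "det (1\<^sub>m s - [:0, 1:] \<cdot>\<^sub>m map_mat (\<lambda>x. [:x:]) (coeff_mat s a)
                  - [:0, 1:]^2 \<cdot>\<^sub>m map_mat (\<lambda>x. [:x:]) (coeff_mat s a_hat)) = pade_den s"
proof -
  define t where "t = s + 1"
  define p where "p j = trunc_poly s (c j)" for j
  define b where "b i = (if i < t then p i else [:0, 1:] * p (i - t))" for i
  define ext :: "(nat \<Rightarrow> nat \<Rightarrow> real) \<Rightarrow> real mat"
    where "ext f = mat t t (\<lambda>(i, j). if i = 0 then 0 else f i j)" for f
  define K where "K = four_block_mat (ext a) (ext a_hat) (1\<^sub>m t) (0\<^sub>m t t)"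
  let ?X = "[:0, 1:] :: real poly"
  let ?h = "map_mat (\<lambda>x::real. [:x:])"
  have ext: "ext f \<in> carrier_mat t t" for f by (simp add: ext_def)
  have K: "K \<in> carrier_mat (t + t) (t + t)" using ext by (simp add: K_def)
  have range: "{0..s} = {..<t}" by (auto simp: t_def)
  have degp: "degree (p i) \<le> 2*s" for i
    by (rule degree_le) (simp add: p_def coeff_trunc_poly)
  have deg: "degree (b i) < t + t" for i
    using degp[of i] degree_mult_le[of ?X "p (i - t)"] degp[of "i - t"]
    by (auto simp: b_def t_def)
  have b_sum: "(\<Sum>l<t + t. Polynomial.smult (v l) (b l))
      = (\<Sum>j<t. Polynomial.smult (v j) (p j)) + ?X * (\<Sum>j<t. Polynomial.smult (v (t + j)) (p j))" for v
    by (simp add: sum_lessThan_add b_def sum_distrib_left del: mult_pCons_left)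
  have Q0: "coeff (pade_den s) 0 = 1" by (simp add: coeff_pade_den del: fact_Suc)
  have p0: "coeff (p i) 0 = 1" for i
    by (simp add: p_def coeff_trunc_poly Q0)
  have "det (mat (t + t) (t + t) (\<lambda>(i, j). coeff (b i) j)) \<noteq> 0"
  proof (rule det_coeff_mat_nonzero)
    fix v i assume "(\<Sum>l<t + t. Polynomial.smult (v l) (b l)) = 0" and i: "i < t + t"
    then have *: "j \<le> s \<Longrightarrow> v j = 0 \<and> v (t + j) = 0" for j
      using trunc_polys_independent[OF assms(1-4), of v "\<lambda>j. v (t + j)" j]
      unfolding b_sum p_def range by blast
    show "v i = 0"
    proof (cases "i < t")
      case True
      then show ?thesis using *[of i] by (simp add: t_def)
    next
      case False
      then show ?thesis using *[of "i - t"] i by (simp add: t_def)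
    qed
  qed (rule deg)
  \<comment> \<open>Row 0 holds since \<open>\<Pi>\<^sub>0 = Q\<^sub>s\<close>; rows
    \<open>1\<close> to \<open>s\<close> are the given identities times \<open>z\<close>, as
    \<open>\<Pi>\<^sub>i(0) = 1\<close>; the rows from \<open>t\<close> on hold since
    \<open>z \<Pi>\<^sub>j\<close> vanishes at 0 and is sent to
    \<open>\<Pi>\<^sub>j\<close>.\<close>
  moreover have "b i - Polynomial.smult (coeff (b i) 0) (pade_den s)
      = ?X * (\<Sum>l<t + t. Polynomial.smult (K $$ (i, l)) (b l))" if i: "i < t + t" for i
  proof -
    have "\<not> i < t \<Longrightarrow> (\<Sum>j<t. Polynomial.smult (K $$ (i, j)) (p j)) = p (i - t)"
      using i by (subst sum.remove[of _ "i - t"]) (auto simp: K_def ext_def intro!: sum.neutral)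
    moreover have "\<not> i < t \<Longrightarrow> (\<Sum>j<t. Polynomial.smult (K $$ (i, t + j)) (p j)) = 0"
      using i by (auto simp: K_def ext_def intro!: sum.neutral)
    moreover have "i < t \<Longrightarrow> (\<Sum>j<t. Polynomial.smult (K $$ (i, j)) (p j))
        = (if i = 0 then 0 else (\<Sum>j<t. Polynomial.smult (a i j) (p j)))"
      by (auto simp: K_def ext_def)
    moreover have "i < t \<Longrightarrow> (\<Sum>j<t. Polynomial.smult (K $$ (i, t + j)) (p j))
        = (if i = 0 then 0 else (\<Sum>j<t. Polynomial.smult (a_hat i j) (p j)))"
      by (auto simp: K_def ext_def)
    moreover have "p i - pade_den s = ?X * ((\<Sum>j<t. Polynomial.smult (a i j) (p j))
        + ?X * (\<Sum>j<t. Polynomial.smult (a_hat i j) (p j)))" if "i < t" "i \<noteq> 0"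
      using assms(5)[of i] that dvd_mult_div_cancel[OF X_dvd_trunc_poly_diff[of s "c i"]]
      unfolding range p_def by (simp add: t_def del: mult_pCons_left)
    moreover have "p 0 = pade_den s"
      using assms(1,2) by (simp add: p_def trunc_poly_0)
    ultimately show ?thesis
      unfolding b_sum by (cases "i < t"; cases "i = 0") (simp_all add: b_def p0 Q0)
  qed
  ultimately have "det (pencil K) = pade_den s"
    using pade_conditions(2)[OF assms(1)] deg Q0
    by (intro det_pencil_division_by_X[OF _ _ K]) (auto simp: t_def)
  also have "det (pencil K) = det (1\<^sub>m t - ?X \<cdot>\<^sub>m ?h (ext a) - ?X^2 \<cdot>\<^sub>m ?h (ext a_hat))"
    unfolding K_def by (rule det_pencil_second_order[OF ext ext])
  \<comment> \<open>Splitting off index 0: row 0 is a unit row, so the coefficients from column 0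
    stay in the lower left block and do not affect the determinant.\<close>
  also have "1\<^sub>m t - ?X \<cdot>\<^sub>m ?h (ext a) - ?X^2 \<cdot>\<^sub>m ?h (ext a_hat)
      = four_block_mat (1\<^sub>m 1) (0\<^sub>m 1 s)
          (mat s 1 (\<lambda>(i, _). - (?X * [:a (i + 1) 0:]) - ?X^2 * [:a_hat (i + 1) 0:]))
          (1\<^sub>m s - ?X \<cdot>\<^sub>m ?h (coeff_mat s a) - ?X^2 \<cdot>\<^sub>m ?h (coeff_mat s a_hat))"
    (is "?N = ?F")
  proof (rule eq_matI)
    fix i j assume "i < dim_row ?F" "j < dim_col ?F"
    then show "?N $$ (i, j) = ?F $$ (i, j)"
      by (cases i; cases j) (auto simp: ext_def coeff_mat_def t_def)
  qed (simp_all add: ext_def coeff_mat_def t_def)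
  also have "det ?F = det (1\<^sub>m s - ?X \<cdot>\<^sub>m ?h (coeff_mat s a) - ?X^2 \<cdot>\<^sub>m ?h (coeff_mat s a_hat))"
    by (subst det_four_block_mat_upper_right_zero[of _ 1 _ s]) (auto simp: coeff_mat_def)
  finally show ?thesis .
qed

end
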